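(* Let $\pi/2\le\alpha<\pi$. Then the equation $$\left\{\left(1+\frac{1}{2\sin\alpha}\big[M_1(r,\alpha)+M_2(r,\alpha)\big]\right)^2+\frac{1}{4\sin^2\alpha}\big(\log[N(r,\alpha)]\big)^2\right\}^2=2\left(1+\frac{1}{2\sin\alpha}\big[M_1(r,\alpha)+M_2(r,\alpha)\big]\right)^2-\frac{1}{2\sin^2\alpha}\big(\log[N(r,\alpha)]\big)^2$$ has a least positive root $r_3\in(0,1)$, the equation $$\left\{\left(1+\frac{1}{2\sin\alpha}\big[M_1(r,\alpha)-M_2(r,\alpha)\big]\right)^2+\frac{1}{4\sin^2\alpha}\big(\log[N(r,\alpha)]\big)^2\right\}^2=2\left(1+\frac{1}{2\sin\alpha}\big[M_1(r,\alpha)-M_2(r,\alpha)\big]\right)^2-\frac{1}{2\sin^2\alpha}\big(\log[N(r,\alpha)]\big)^2$$ has a least positive root $r_4\in(0,1)$, and, with $r_0:=\min\{r_3,r_4\}$, $\mathcal{MS}(\alpha)\subset\mathcal{SL}$ for $|z|\le r_0$; that is, for every $f\in\mathcal{MS}(\alpha)$ and every $z$ with $|z|\le r_0$, the value $zf'(z)/f(z)$ lies in the region $\{\sqrt{1+\zeta}:\zeta\in\mathbb{U}\}$.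
   Context: $\mathbb{U}=\{z\in\mathbb{C}:|z|<1\}$. $\mathcal{A}$ is the class of functions $f(z)=z+\sum_{n=2}^\infty a_nz^n$ that are analytic and univalent in $\mathbb{U}$. For $\pi/2\le\alpha<\pi$, $\mathcal{MS}(\alpha)$ is the class of all $f\in\mathcal{A}$ such that $$1+\frac{\alpha-\pi}{2\sin\alpha}<\Re\left(\frac{zf'(z)}{f(z)}\right)<1+\frac{\alpha}{2\sin\alpha}\qquad(z\in\mathbb{U}),$$ where $zf'(z)/f(z)$ is given the value $1$ at $z=0$. $\mathcal{SL}$ is the class of $f\in\mathcal{A}$ such that $zf'(z)/f(z)$ is subordinate to $\sqrt{1+z}$ in $\mathbb{U}$ (principal branch of the square root); since $\sqrt{1+z}$ is univalent with value $1$ at $0$, this means that $zf'(z)/f(z)\in\{\sqrt{1+\zeta}:\zeta\in\mathbb{U}\}$ for all $z\in\mathbb{U}$. An inclusion "for $|z|\le\rho$" means that every function of the first class satisfies this defining condition of the second class at all $z$ with $|z|\le\rho$. For $0\le r<1$, $$M_1(r,\alpha)=\arcsin\left(\frac{-r^2\sin2\alpha}{\sqrt{1-2r^2\cos2\alpha+r^4}}\right),\qquad M_2(r,\alpha)=\arcsin\left(\frac{2r\sin\alpha}{\sqrt{1-2r^2\cos2\alpha+r^4}}\right),$$ $$N(r,\alpha)=\frac{\sqrt{1-2r^2\cos2\alpha+r^4}+2r\sin\alpha}{1-r^2},$$ with $\arcsin$ taking values in $[-\pi/2,\pi/2]$. *)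

theory Defs
  imports "HOL-Complex_Analysis.Complex_Analysis"
begin

text \<open>Functions are total on the complex plane; only their values on the open unit disc
  \<^term>\<open>ball (0::complex) 1\<close> are constrained.\<close>

definition class_A :: "(complex \<Rightarrow> complex) set" where
  "class_A = {f. f analytic_on ball 0 1 \<and> inj_on f (ball 0 1) \<and>
     (\<exists>a :: nat \<Rightarrow> complex. \<forall>z\<in>ball 0 1.
        (\<lambda>n. a (n + 2) * z ^ (n + 2)) sums (f z - z))}"

definition starlike_quot :: "(complex \<Rightarrow> complex) \<Rightarrow> complex \<Rightarrow> complex" where
  "starlike_quot f z = (if z = 0 then 1 else z * deriv f z / f z)"

definition class_MS :: "real \<Rightarrow> (complex \<Rightarrow> complex) set" where
  "class_MS \<alpha> = {f \<in> class_A. \<forall>z\<in>ball 0 1.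
     1 + (\<alpha> - pi) / (2 * sin \<alpha>) < Re (starlike_quot f z) \<and>
     Re (starlike_quot f z) < 1 + \<alpha> / (2 * sin \<alpha>)}"

definition SL_region :: "complex set" where
  "SL_region = (\<lambda>\<zeta>. csqrt (1 + \<zeta>)) ` ball 0 1"

text \<open>The class \<open>\<S>\<L>\<close> is \<open>class_SL_on (ball 0 1)\<close>: as \<open>csqrt (1 + \<zeta>)\<close> is univalent on the unit
  disc with value 1 at 0, taking values in its image is subordination to it. An inclusion
  in \<open>\<S>\<L>\<close> for \<open>\<bar>z\<bar> \<le> \<rho>\<close> is an inclusion in \<open>class_SL_on (cball 0 \<rho>)\<close>.\<close>

definition class_SL_on :: "complex set \<Rightarrow> (complex \<Rightarrow> complex) set" where
  "class_SL_on S = {f \<in> class_A. \<forall>z\<in>S. starlike_quot f z \<in> SL_region}"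

definition M1 :: "real \<Rightarrow> real \<Rightarrow> real" where
  "M1 r \<alpha> = arcsin (- (r\<^sup>2) * sin (2 * \<alpha>) / sqrt (1 - 2 * r\<^sup>2 * cos (2 * \<alpha>) + r ^ 4))"

definition M2 :: "real \<Rightarrow> real \<Rightarrow> real" where
  "M2 r \<alpha> = arcsin (2 * r * sin \<alpha> / sqrt (1 - 2 * r\<^sup>2 * cos (2 * \<alpha>) + r ^ 4))"

definition N :: "real \<Rightarrow> real \<Rightarrow> real" where
  "N r \<alpha> = (sqrt (1 - 2 * r\<^sup>2 * cos (2 * \<alpha>) + r ^ 4) + 2 * r * sin \<alpha>) / (1 - r\<^sup>2)"

text \<open>\<open>m\<close> stands for \<open>M1 r \<alpha> + M2 r \<alpha>\<close> or \<open>M1 r \<alpha> - M2 r \<alpha>\<close>, and \<open>l\<close> for \<open>ln (N r \<alpha>)\<close>.\<close>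

definition lemniscate_eq :: "real \<Rightarrow> real \<Rightarrow> real \<Rightarrow> bool" where
  "lemniscate_eq \<alpha> m l \<longleftrightarrow>
     ((1 + 1 / (2 * sin \<alpha>) * m)\<^sup>2 + 1 / (4 * (sin \<alpha>)\<^sup>2) * l\<^sup>2)\<^sup>2 =
     2 * (1 + 1 / (2 * sin \<alpha>) * m)\<^sup>2 - 1 / (2 * (sin \<alpha>)\<^sup>2) * l\<^sup>2"

definition least_positive_root :: "(real \<Rightarrow> bool) \<Rightarrow> real \<Rightarrow> bool" where
  "least_positive_root E r \<longleftrightarrow> 0 < r \<and> E r \<and> (\<forall>s. 0 < s \<and> E s \<longrightarrow> r \<le> s)"

end

theory Submission
  imports Defs
begin

text \<open>
  Why the inclusion holds. For \<open>f\<close> in the class \<open>class_MS \<alpha>\<close>, the function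
  \<open>X = 2 sin \<alpha> (z f'/f - 1)\<close> vanishes at \<open>0\<close> and maps the unit disc into the strip
  \<open>\<alpha> - \<pi> < Re < \<alpha>\<close>. Hence \<open>W = exp (i X)\<close> lies in the half plane of all points closer to
  \<open>1\<close> than to \<open>exp (2 i \<alpha>)\<close>, and the Schwarz lemma, applied to
  \<open>(W - 1) / (W - exp (2 i \<alpha>))\<close>, places \<open>W(z)\<close> for \<open>\<bar>z\<bar> = r\<close> in an Apollonius disc
  (\<open>strip_Schwarz\<close>). That disc has centre \<open>c = (1 - r\<^sup>2 exp (2 i \<alpha>)) / (1 - r\<^sup>2)\<close> and radius
  \<open>R = 2 r sin \<alpha> / (1 - r\<^sup>2)\<close>, where \<open>\<bar>c\<bar>\<^sup>2 - R\<^sup>2 = 1\<close>. Its points have argument between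
  \<open>M1 - M2\<close> and \<open>M1 + M2\<close>, as \<open>M1 = arg c\<close> and \<open>M2 = arcsin (R / \<bar>c\<bar>)\<close>, and modulus between
  \<open>1 / N\<close> and \<open>N = \<bar>c\<bar> + R\<close>. So \<open>z f'/f\<close> takes its value in a rectangle whose four
  corners are the points that the two equations put on the lemniscate
  (\<open>disc_log_in_rectangle\<close>).

  The image of \<open>sqrt (1 + \<zeta>)\<close> is the right half of the interior of Bernoulli's lemniscate
  \<open>(x\<^sup>2 + y\<^sup>2)\<^sup>2 = 2 x\<^sup>2 - 2 y\<^sup>2\<close>. The corners start at the interior point \<open>1\<close> for \<open>r = 0\<close>,
  leave the lemniscate since \<open>N\<close> tends to infinity for \<open>r\<close> to \<open>1\<close>, and by continuity
  cannot cross it before the least root (\<open>corner_least_root\<close>); nor can a left corner get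
  past the node at the origin (\<open>corner_positive\<close>). A rectangle with corners in the
  closed right loop lies in that loop, and touches the curve at most in its corners
  (\<open>rectangle_in_bernoulli\<close>). The value of \<open>z f'/f\<close> is never a corner, because the extreme
  moduli in the disc occur in the direction of the centre while the extreme arguments occur
  at the points of tangency. This gives the open region even on the boundary circle
  \<open>\<bar>z\<bar> = min r3 r4\<close>.
\<close>

section \<open>The quotient \<open>z f'(z) / f(z)\<close> is holomorphic\<close>

text \<open>The singularity of \<open>z f'(z) / f(z)\<close> at \<open>0\<close> is removed by writing \<open>f(z) = z g(z)\<close>. The power
  series gives \<open>g\<close>, and univalence keeps \<open>f\<close>, hence \<open>g\<close>, from vanishing off the origin.\<close>

lemma class_A_factor:
  assumes "f \<in> class_A"
  obtains g where "g holomorphic_on ball 0 1" "g 0 = 1"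
    "\<And>z. z \<in> ball 0 1 \<Longrightarrow> f z = z * g z" "\<And>z. z \<in> ball 0 1 \<Longrightarrow> g z \<noteq> 0"
proof -
  obtain a :: "nat \<Rightarrow> complex" where
    a: "\<And>z. z \<in> ball 0 1 \<Longrightarrow> (\<lambda>n. a (n + 2) * z ^ (n + 2)) sums (f z - z)"
    using assms unfolding class_A_def by blast
  have inj: "inj_on f (ball 0 1)"
    using assms by (auto simp: class_A_def)
  define h where "h = (\<lambda>z. if z = 0 then a 2 else (f z - z) / z\<^sup>2)"
  have f0: "f 0 = 0"
  proof -
    have "(\<lambda>n. a (n + 2) * 0 ^ (n + 2)) sums (f 0 - 0)"
      by (rule a) auto
    then show ?thesis
      using sums_unique2[OF _ sums_zero] by simp
  qed
  have "(\<lambda>n. a (n + 2) * (z - 0) ^ n) sums h z" if z: "z \<in> ball 0 1" for z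
  proof (cases "z = 0")
    case True
    then show ?thesis
      using powser_sums_zero[of "\<lambda>n. a (n + 2)"] by (simp add: h_def numeral_2_eq_2)
  next
    case False
    have "(\<lambda>n. z\<^sup>2 * (a (n + 2) * z ^ n)) sums (f z - z)"
      using a[OF z] by (simp add: power_add power2_eq_square mult_ac)
    from sums_mult_D[OF this] False show ?thesis
      by (simp add: h_def)
  qed
  then have h: "h holomorphic_on ball 0 1"
    by (rule power_series_holomorphic)
  define g where "g = (\<lambda>z. 1 + z * h z)"
  have fg: "f z = z * g z" for z
    using f0 by (cases "z = 0") (auto simp: g_def h_def field_simps power2_eq_square)
  show thesis
  proof
    show "g holomorphic_on ball 0 1"
      unfolding g_def by (intro holomorphic_intros h)
    show g0: "g 0 = 1"
      by (simp add: g_def)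
    fix z :: complex assume z: "z \<in> ball 0 1"
    show "f z = z * g z"
      by (rule fg)
    show "g z \<noteq> 0"
    proof
      assume gz: "g z = 0"
      then have "f z = f 0"
        using fg[of z] f0 by simp
      then have "z = 0"
        using inj z by (auto simp: inj_on_def)
      then show False
        using gz g0 by simp
    qed
  qed
qed

lemma starlike_quot_holomorphic:
  assumes "f \<in> class_A"
  shows "starlike_quot f holomorphic_on ball 0 1"
proof -
  obtain g where g: "g holomorphic_on ball 0 1" "g 0 = 1"
    and fg: "\<And>z. z \<in> ball 0 1 \<Longrightarrow> f z = z * g z"
    and g_nz: "\<And>z. z \<in> ball 0 1 \<Longrightarrow> g z \<noteq> 0"
    using class_A_factor[OF assms] by metis
  have f: "f holomorphic_on ball 0 1"
    using assms by (simp add: class_A_def analytic_imp_holomorphic)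
  have "(g has_field_derivative deriv g 0) (at 0)"
    by (rule holomorphic_derivI[OF g(1)]) auto
  then have "((\<lambda>z. z * g z) has_field_derivative 1) (at 0)"
    by (auto intro!: derivative_eq_intros simp: g(2))
  moreover have "eventually (\<lambda>z. z * g z = f z) (nhds 0)"
    using fg by (intro eventually_nhds_in_open[THEN eventually_mono, of "ball 0 1"]) auto
  ultimately have "(f has_field_derivative 1) (at 0)"
    using DERIV_cong_ev[of 0 0 "\<lambda>z. z * g z" f 1 1] by simp
  then have f'0: "deriv f 0 = 1"
    by (rule DERIV_imp_deriv)
  have "(\<lambda>z. deriv f z / g z) holomorphic_on ball 0 1"
    by (intro holomorphic_intros holomorphic_deriv f g g_nz) auto
  moreover have "deriv f z / g z = starlike_quot f z" if "z \<in> ball 0 1" for z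
    using fg[OF that] f'0 g(2) by (simp add: starlike_quot_def)
  ultimately show ?thesis
    by (rule holomorphic_transform)
qed

section \<open>The Schwarz lemma for a vertical strip\<close>

text \<open>The modulus of \<open>exp (i X)\<close> is \<open>exp (- Im X)\<close>; pulling it out of the law of cosines leaves a
  factor symmetric in \<open>Im X\<close>. For two values of \<open>\<beta>\<close> the prefactor is the same, so that
  comparing distances to two points of the unit circle reduces to the bracket.\<close>

lemma norm_exp_minus_cis:
  "(cmod (exp (\<i> * X) - cis \<beta>))\<^sup>2 = 2 * exp (- Im X) * (cosh (Im X) - cos (Re X - \<beta>))"
proof -
  have c: "2 * exp (- Im X) * cosh (Im X) = 1 + (exp (- Im X))\<^sup>2"
    by (simp add: cosh_def field_simps power2_eq_square exp_minus)
  have "(cmod (exp (\<i> * X) - cis \<beta>))\<^sup>2 =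
      (exp (- Im X) * cos (Re X) - cos \<beta>)\<^sup>2 + (exp (- Im X) * sin (Re X) - sin \<beta>)\<^sup>2"
    by (simp add: cmod_power2 Re_exp Im_exp)
  also have "\<dots> = (exp (- Im X))\<^sup>2 + 1
      - 2 * exp (- Im X) * (cos (Re X) * cos \<beta> + sin (Re X) * sin \<beta>)"
    using sin_cos_squared_add[of "Re X"] sin_cos_squared_add[of \<beta>] by algebra
  finally show ?thesis
    using c by (simp add: cos_diff algebra_simps)
qed

text \<open>The exponential maps the strip onto the half plane of points closer to \<open>1\<close> than to its
  mirror image \<open>cis (2 * \<alpha>)\<close>, so the quotient of the differences to these two points is a
  self-map of the unit disc fixing \<open>0\<close>. The conclusion is the Schwarz lemma for it.\<close>

lemma strip_Schwarz:
  fixes \<alpha> :: real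
  assumes \<alpha>: "0 < \<alpha>" "\<alpha> < pi"
    and X: "X holomorphic_on ball 0 1" "X 0 = 0"
    and strip: "\<And>z. cmod z < 1 \<Longrightarrow> \<alpha> - pi < Re (X z) \<and> Re (X z) < \<alpha>"
    and z: "cmod z < 1"
  shows "(1 - (cmod z)\<^sup>2) * cosh (Im (X z)) \<le>
    cos (Re (X z)) - (cmod z)\<^sup>2 * cos (Re (X z) - 2 * \<alpha>)"
proof -
  define num where "num = (\<lambda>z. exp (\<i> * X z) - cis 0)"
  define den where "den = (\<lambda>z. exp (\<i> * X z) - cis (2 * \<alpha>))"
  have less: "cmod (num w) < cmod (den w)" if w: "cmod w < 1" for w
  proof -
    let ?p = "Re (X w)"
    \<comment> \<open>\<open>cos p - cos (p - 2 \<alpha>) = 2 sin (\<alpha> - p) sin \<alpha>\<close> is positive exactly because \<open>0 < \<alpha> - p < \<pi>\<close>\<close>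
    have "0 < sin (\<alpha> - ?p) * sin \<alpha>"
      using \<alpha> strip[OF w] by (intro mult_pos_pos sin_gt_zero) auto
    moreover have "cos ?p = cos (\<alpha> - (\<alpha> - ?p))" "cos (?p - 2 * \<alpha>) = cos (\<alpha> + (\<alpha> - ?p))"
      using cos_minus[of "?p - 2 * \<alpha>"] by (simp_all add: algebra_simps)
    ultimately have "cos (?p - 2 * \<alpha>) < cos ?p"
      by (simp only: cos_diff cos_add) (simp add: mult.commute)
    then have "(cmod (num w))\<^sup>2 < (cmod (den w))\<^sup>2"
      unfolding num_def den_def norm_exp_minus_cis by simp
    then show ?thesis
      using power2_less_imp_less norm_ge_zero by blast
  qed
  have den_nz: "den w \<noteq> 0" if "cmod w < 1" for w
    using less[OF that] by (auto simp: not_less)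
  have "cmod (num z / den z) \<le> cmod z"
  proof (rule Schwarz_Lemma(1))
    show "(\<lambda>w. num w / den w) holomorphic_on ball 0 1"
      using den_nz unfolding num_def den_def by (intro holomorphic_intros X) auto
    show "num 0 / den 0 = 0"
      by (simp add: num_def X)
    show "cmod (num w / den w) < 1" if "cmod w < 1" for w
      using less[OF that] den_nz[OF that] by (simp add: norm_divide divide_simps)
  qed (use z in auto)
  then have "cmod (num z) \<le> cmod z * cmod (den z)"
    using den_nz[OF z] by (simp add: norm_divide divide_simps)
  then have "(cmod (num z))\<^sup>2 \<le> (cmod z)\<^sup>2 * (cmod (den z))\<^sup>2"
    using power_mono[of "cmod (num z)" "cmod z * cmod (den z)" 2] by (simp add: power_mult_distrib)
  then have "2 * exp (- Im (X z)) * (cosh (Im (X z)) - cos (Re (X z))) \<le>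
      2 * exp (- Im (X z)) * ((cmod z)\<^sup>2 * (cosh (Im (X z)) - cos (Re (X z) - 2 * \<alpha>)))"
    unfolding num_def den_def norm_exp_minus_cis by (simp add: mult_ac)
  then have "cosh (Im (X z)) - cos (Re (X z)) \<le>
      (cmod z)\<^sup>2 * (cosh (Im (X z)) - cos (Re (X z) - 2 * \<alpha>))"
    by simp
  then show ?thesis
    by (simp add: algebra_simps)
qed

section \<open>The rectangle swept out by the logarithm of a disc\<close>

text \<open>The Apollonius disc in which \<open>exp (i X)\<close> lies has centre \<open>c = (1 - r\<^sup>2 cis (2 \<alpha>)) / (1 - r\<^sup>2)\<close>;
  \<open>center_norm r \<alpha>\<close> is \<open>(1 - r\<^sup>2) \<bar>c\<bar>\<close>.\<close>

definition center_norm :: "real \<Rightarrow> real \<Rightarrow> real" where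
  "center_norm r \<alpha> = sqrt (1 - 2 * r\<^sup>2 * cos (2 * \<alpha>) + r ^ 4)"

lemma center_norm_radicand:
  fixes r \<alpha> :: real
  shows "1 - 2 * r\<^sup>2 * cos (2 * \<alpha>) + r ^ 4 = (1 - r\<^sup>2)\<^sup>2 + (2 * r * sin \<alpha>)\<^sup>2"
  by (simp add: cos_double_sin) algebra

text \<open>Two right triangles with hypotenuse \<open>\<bar>c\<bar>\<close>, scaled by \<open>1 - r\<^sup>2\<close>. In the first, the legs come from the
  tangent of length \<open>1\<close> from the origin to the disc and from the radius; the second splits the
  centre into real and imaginary part. The angles of these triangles are \<open>M2\<close> and \<open>M1\<close>.\<close>

lemma center_norm_sq:
  "(center_norm r \<alpha>)\<^sup>2 = (1 - r\<^sup>2)\<^sup>2 + (2 * r * sin \<alpha>)\<^sup>2"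
  "(center_norm r \<alpha>)\<^sup>2 = (1 - r\<^sup>2 * cos (2 * \<alpha>))\<^sup>2 + (- (r\<^sup>2) * sin (2 * \<alpha>))\<^sup>2"
proof -
  note 1 = center_norm_radicand[of r \<alpha>]
  have "1 - 2 * r\<^sup>2 * cos (2 * \<alpha>) + r ^ 4 \<ge> 0"
    unfolding 1 by simp
  then have 2: "(center_norm r \<alpha>)\<^sup>2 = 1 - 2 * r\<^sup>2 * cos (2 * \<alpha>) + r ^ 4"
    unfolding center_norm_def by (rule real_sqrt_pow2)
  show "(center_norm r \<alpha>)\<^sup>2 = (1 - r\<^sup>2)\<^sup>2 + (2 * r * sin \<alpha>)\<^sup>2"
    using 1 2 by simp
  have "1 - 2 * r\<^sup>2 * cos (2 * \<alpha>) + r ^ 4 =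
      (1 - r\<^sup>2 * cos (2 * \<alpha>))\<^sup>2 + (- (r\<^sup>2) * sin (2 * \<alpha>))\<^sup>2"
    using sin_cos_squared_add[of "2 * \<alpha>"] by algebra
  then show "(center_norm r \<alpha>)\<^sup>2 = (1 - r\<^sup>2 * cos (2 * \<alpha>))\<^sup>2 + (- (r\<^sup>2) * sin (2 * \<alpha>))\<^sup>2"
    using 2 by simp
qed

lemma center_norm_pos:
  assumes "0 \<le> r" "r < 1"
  shows "0 < center_norm r \<alpha>"
proof -
  have "r\<^sup>2 < 1"
    using assms by (simp add: power_less_one_iff)
  then have "0 < (center_norm r \<alpha>)\<^sup>2"
    unfolding center_norm_sq(1) by (intro add_pos_nonneg) auto
  moreover have "0 \<le> center_norm r \<alpha>"
    using center_norm_radicand[of r \<alpha>] by (simp add: center_norm_def)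
  ultimately show ?thesis
    by (auto simp: order_less_le)
qed

lemma triangle_arcsin:
  fixes a b d :: real
  assumes "d\<^sup>2 = a\<^sup>2 + b\<^sup>2" "0 \<le> a" "0 < d"
  shows "- 1 \<le> b / d \<and> b / d \<le> 1" "sin (arcsin (b / d)) = b / d" "cos (arcsin (b / d)) = a / d"
proof -
  have "\<bar>b\<bar> \<le> \<bar>d\<bar>"
    using assms(1) by (simp add: abs_le_square_iff)
  then show *: "- 1 \<le> b / d \<and> b / d \<le> 1"
    using assms(3) by (auto simp: divide_simps abs_le_iff)
  then show "sin (arcsin (b / d)) = b / d"
    by simp
  have "(a / d)\<^sup>2 + (b / d)\<^sup>2 = d\<^sup>2 / d\<^sup>2"
    by (simp add: power_divide add_divide_distrib[symmetric] assms(1))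
  then have "1 - (b / d)\<^sup>2 = (a / d)\<^sup>2"
    using assms(3) by simp
  then show "cos (arcsin (b / d)) = a / d"
    using * assms by (simp add: cos_arcsin)
qed

text \<open>By the last item, the inequality of \<open>strip_Schwarz\<close> depends on the argument \<open>t\<close> only
  through its deviation from the argument \<open>M1\<close> of the centre.\<close>

lemma M1_trig:
  assumes r: "0 \<le> r" "r < 1"
  shows "- (pi / 2) \<le> M1 r \<alpha>" "M1 r \<alpha> \<le> pi / 2"
    "- 1 \<le> - (r\<^sup>2) * sin (2 * \<alpha>) / center_norm r \<alpha> \<and> - (r\<^sup>2) * sin (2 * \<alpha>) / center_norm r \<alpha> \<le> 1"
    "center_norm r \<alpha> * cos (t - M1 r \<alpha>) = cos t - r\<^sup>2 * cos (t - 2 * \<alpha>)"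
proof -
  have r2: "r\<^sup>2 \<le> 1"
    using r by (simp add: power_le_one)
  have "r\<^sup>2 * cos (2 * \<alpha>) \<le> 1 * 1"
    using r2 cos_le_one[of "2 * \<alpha>"] mult_left_mono[of "cos (2 * \<alpha>)" 1 "r\<^sup>2"] by simp
  then have "0 \<le> 1 - r\<^sup>2 * cos (2 * \<alpha>)"
    by simp
  note T = triangle_arcsin[OF center_norm_sq(2) this center_norm_pos[OF r]]
  have M1: "M1 r \<alpha> = arcsin (- (r\<^sup>2) * sin (2 * \<alpha>) / center_norm r \<alpha>)"
    by (simp add: M1_def center_norm_def)
  show range: "- 1 \<le> - (r\<^sup>2) * sin (2 * \<alpha>) / center_norm r \<alpha> \<and> - (r\<^sup>2) * sin (2 * \<alpha>) / center_norm r \<alpha> \<le> 1"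
    by (rule T(1))
  show "- (pi / 2) \<le> M1 r \<alpha>" "M1 r \<alpha> \<le> pi / 2"
    using arcsin_bounded range unfolding M1 by auto
  show "center_norm r \<alpha> * cos (t - M1 r \<alpha>) = cos t - r\<^sup>2 * cos (t - 2 * \<alpha>)"
    unfolding M1 cos_diff T(2,3) using center_norm_pos[OF r, of \<alpha>] by (simp add: field_simps)
qed

lemma M2_trig:
  assumes r: "0 \<le> r" "r < 1" and s: "0 < sin \<alpha>"
  shows "0 \<le> M2 r \<alpha>" "M2 r \<alpha> \<le> pi / 2" "0 < r \<Longrightarrow> 0 < M2 r \<alpha>"
    "- 1 \<le> 2 * r * sin \<alpha> / center_norm r \<alpha> \<and> 2 * r * sin \<alpha> / center_norm r \<alpha> \<le> 1"
    "center_norm r \<alpha> * cos (M2 r \<alpha>) = 1 - r\<^sup>2"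
proof -
  have "0 \<le> 1 - r\<^sup>2"
    using r by (simp add: power_le_one)
  note T = triangle_arcsin[OF center_norm_sq(1) this center_norm_pos[OF r]]
  have M2: "M2 r \<alpha> = arcsin (2 * r * sin \<alpha> / center_norm r \<alpha>)"
    by (simp add: M2_def center_norm_def)
  show range: "- 1 \<le> 2 * r * sin \<alpha> / center_norm r \<alpha> \<and> 2 * r * sin \<alpha> / center_norm r \<alpha> \<le> 1"
    by (rule T(1))
  have bounds: "- (pi / 2) \<le> M2 r \<alpha>" "M2 r \<alpha> \<le> pi / 2"
    using arcsin_bounded range unfolding M2 by auto
  then show "M2 r \<alpha> \<le> pi / 2"
    by simp
  have sinM2: "sin (M2 r \<alpha>) = 2 * r * sin \<alpha> / center_norm r \<alpha>"
    unfolding M2 by (rule T(2))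
  have sgn: "0 \<le> sin (M2 r \<alpha>)"
    unfolding sinM2 using r s center_norm_pos[OF r, of \<alpha>] by simp
  then show ge: "0 \<le> M2 r \<alpha>"
    using sin_gt_zero[of "- M2 r \<alpha>"] bounds by (cases "M2 r \<alpha> < 0") auto
  show "0 < M2 r \<alpha>" if "0 < r"
  proof -
    have "sin (M2 r \<alpha>) \<noteq> 0"
      unfolding sinM2 using that s center_norm_pos[OF r, of \<alpha>] by simp
    then show ?thesis
      using ge by (auto simp: order_less_le)
  qed
  show "center_norm r \<alpha> * cos (M2 r \<alpha>) = 1 - r\<^sup>2"
    unfolding M2 T(3) using center_norm_pos[OF r, of \<alpha>] by simp
qed

text \<open>As the tangent from the origin has length \<open>1\<close>, the extreme moduli \<open>\<bar>c\<bar> \<plusminus> R\<close> are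
  reciprocal to each other. Their mean is \<open>\<bar>c\<bar>\<close>, which is therefore \<open>cosh (ln N)\<close>.\<close>

lemma ln_N:
  assumes r: "0 \<le> r" "r < 1" and s: "0 < sin \<alpha>"
  shows "0 < N r \<alpha>" "0 \<le> ln (N r \<alpha>)" "0 < r \<Longrightarrow> 0 < ln (N r \<alpha>)"
    "(1 - r\<^sup>2) * cosh (ln (N r \<alpha>)) = center_norm r \<alpha>"
proof -
  let ?D = "center_norm r \<alpha>" and ?t = "2 * r * sin \<alpha>"
  have q: "0 < 1 - r\<^sup>2"
    using r by (simp add: power_less_one_iff)
  have N: "N r \<alpha> = (?D + ?t) / (1 - r\<^sup>2)"
    by (simp add: N_def center_norm_def)
  have t: "0 \<le> ?t" "0 < r \<Longrightarrow> 0 < ?t"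
    using r s by auto
  have D: "1 - r\<^sup>2 \<le> ?D"
  proof (rule power2_le_imp_le)
    show "(1 - r\<^sup>2)\<^sup>2 \<le> ?D\<^sup>2"
      unfolding center_norm_sq(1) by simp
    show "0 \<le> ?D"
      using center_norm_pos[OF r] by (rule less_imp_le)
  qed
  have ge1: "1 \<le> N r \<alpha>"
    unfolding N using D t q by simp
  then show pos: "0 < N r \<alpha>" and "0 \<le> ln (N r \<alpha>)"
    by simp_all
  show "0 < ln (N r \<alpha>)" if "0 < r"
  proof -
    have "1 < N r \<alpha>"
      unfolding N using D t(2)[OF that] q by simp
    then show ?thesis
      by simp
  qed
  have prod: "(?D + ?t) * (?D - ?t) = (1 - r\<^sup>2)\<^sup>2"
    using center_norm_sq(1)[of r \<alpha>] by algebra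
  have "?D + ?t > 0"
    using center_norm_pos[OF r, of \<alpha>] t by simp
  then have "inverse (N r \<alpha>) = (?D - ?t) / (1 - r\<^sup>2)"
    unfolding N using prod q by (simp add: divide_simps power2_eq_square mult.commute)
  then have "(N r \<alpha> + inverse (N r \<alpha>)) / 2 = ?D / (1 - r\<^sup>2)"
    unfolding N by (simp only: add_divide_distrib diff_divide_distrib)
  then have "cosh (ln (N r \<alpha>)) = ?D / (1 - r\<^sup>2)"
    by (simp only: cosh_ln_real[OF pos])
  then show "(1 - r\<^sup>2) * cosh (ln (N r \<alpha>)) = ?D"
    using q by simp
qed

text \<open>The hypothesis \<open>disc\<close> says \<open>cosh h \<le> \<bar>c\<bar> cos (\<phi> - M1)\<close>, which couples the two coordinates.
  Using \<open>1 \<le> cosh h\<close> bounds the argument, using \<open>cos (\<phi> - M1) \<le> 1\<close> bounds the log-modulus.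
  The second estimate is strict unless \<open>\<phi> = M1\<close>, and then the first one is: so the disc
  avoids the corners of the rectangle.\<close>

lemma disc_log_in_rectangle:
  assumes \<alpha>: "0 < \<alpha>" "\<alpha> < pi" and r: "0 < r" "r < 1"
    and \<phi>: "\<alpha> - pi < \<phi>" "\<phi> < \<alpha>"
    and disc: "(1 - r\<^sup>2) * cosh h \<le> cos \<phi> - r\<^sup>2 * cos (\<phi> - 2 * \<alpha>)"
  shows "\<bar>\<phi> - M1 r \<alpha>\<bar> \<le> M2 r \<alpha>" "\<bar>h\<bar> \<le> ln (N r \<alpha>)"
    "\<bar>\<phi> - M1 r \<alpha>\<bar> < M2 r \<alpha> \<or> \<bar>h\<bar> < ln (N r \<alpha>)"
proof -
  let ?D = "center_norm r \<alpha>" and ?u = "\<bar>\<phi> - M1 r \<alpha>\<bar>"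
  have s: "0 < sin \<alpha>"
    using \<alpha> by (rule sin_gt_zero)
  have r0: "0 \<le> r"
    using r by simp
  note M1 = M1_trig[OF r0 r(2), of \<alpha>] and M2 = M2_trig[OF r0 r(2) s]
    and N = ln_N[OF r0 r(2) s]
  have q: "0 < 1 - r\<^sup>2"
    using r by (simp add: power_less_one_iff)
  have D: "0 < ?D"
    using center_norm_pos[OF r0 r(2)] .
  have main: "(1 - r\<^sup>2) * cosh h \<le> ?D * cos ?u"
    using disc M1(4)[of \<phi>] by simp
  have "(1 - r\<^sup>2) * 1 \<le> (1 - r\<^sup>2) * cosh h"
    using q cosh_real_ge_1[of h] by (intro mult_left_mono) auto
  then have ge: "1 - r\<^sup>2 \<le> ?D * cos ?u"
    using main by simp
  have u_pos: "0 < cos ?u"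
    using ge q D by (smt (verit) mult_nonneg_nonpos)
  \<comment> \<open>A positive cosine locates \<open>?u\<close> modulo \<open>2 * pi\<close>; the strip singles out the branch next to \<open>0\<close>.\<close>
  have u_pi: "?u < pi / 2"
  proof (rule ccontr)
    assume "\<not> ?u < pi / 2"
    moreover have "?u < 3 * pi / 2"
      using \<phi> \<alpha> M1(1,2) by linarith
    ultimately have "0 \<le> cos (?u - pi)"
      by (intro cos_ge_zero) auto
    then show False
      using u_pos by (simp add: cos_diff)
  qed
  have "?D * cos (M2 r \<alpha>) \<le> ?D * cos ?u"
    using ge M2(5) by simp
  then have "cos (M2 r \<alpha>) \<le> cos ?u"
    using D by simp
  then show "?u \<le> M2 r \<alpha>"
    using M2(1,2) u_pi by (subst (asm) cos_mono_le_eq) auto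
  have h_le: "\<bar>h\<bar> \<le> ln (N r \<alpha>) \<longleftrightarrow> cosh h \<le> cosh (ln (N r \<alpha>))"
    using cosh_real_nonneg_le_iff[of "\<bar>h\<bar>"] N(2) by simp
  have h_less: "\<bar>h\<bar> < ln (N r \<alpha>) \<longleftrightarrow> cosh h < cosh (ln (N r \<alpha>))"
    using cosh_real_nonneg_less_iff[of "\<bar>h\<bar>"] N(2) by simp
  have "?D * cos ?u \<le> ?D * 1"
    using D by (intro mult_left_mono) auto
  then have "(1 - r\<^sup>2) * cosh h \<le> (1 - r\<^sup>2) * cosh (ln (N r \<alpha>))"
    using main N(4) by simp
  then show "\<bar>h\<bar> \<le> ln (N r \<alpha>)"
    unfolding h_le using q by simp
  show "?u < M2 r \<alpha> \<or> \<bar>h\<bar> < ln (N r \<alpha>)"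
  proof (cases "?u = 0")
    case True
    then show ?thesis
      using M2(3) r by simp
  next
    case False
    then have "cos ?u < cos 0"
      using u_pi pi_gt_zero by (intro cos_monotone_0_pi) linarith+
    then have "?D * cos ?u < ?D * 1"
      using D by simp
    then have "(1 - r\<^sup>2) * cosh h < (1 - r\<^sup>2) * cosh (ln (N r \<alpha>))"
      using main N(4) by simp
    then show ?thesis
      unfolding h_less using q by simp
  qed
qed

section \<open>The lemniscate of Bernoulli\<close>

definition bernoulli :: "real \<Rightarrow> real \<Rightarrow> real" where
  "bernoulli x y = (x\<^sup>2 + y\<^sup>2)\<^sup>2 - 2 * x\<^sup>2 + 2 * y\<^sup>2"

text \<open>Here \<open>w = csqrt (1 + \<zeta>)\<close> with \<open>\<zeta> = w\<^sup>2 - 1\<close>, and \<open>\<bar>w\<^sup>2 - 1\<bar>\<^sup>2 = bernoulli (Re w) (Im w) + 1\<close>.\<close>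

lemma mem_SL_region:
  assumes "0 < Re w" "bernoulli (Re w) (Im w) < 0"
  shows "w \<in> SL_region"
proof -
  have "(cmod (w\<^sup>2 - 1))\<^sup>2 = bernoulli (Re w) (Im w) + 1"
    unfolding cmod_power2 bernoulli_def by (simp add: power2_eq_square) algebra
  then have "(cmod (w\<^sup>2 - 1))\<^sup>2 < 1"
    using assms by simp
  then have "w\<^sup>2 - 1 \<in> ball 0 1"
    using power2_less_imp_less[of "cmod (w\<^sup>2 - 1)" 1] by simp
  moreover have "w = csqrt (1 + (w\<^sup>2 - 1))"
    using assms by (simp add: csqrt_square)
  ultimately show ?thesis
    unfolding SL_region_def by blast
qed

text \<open>For fixed \<open>L\<close>, \<open>bernoulli x L\<close> is a quadratic polynomial in \<open>x\<^sup>2\<close> with leading coefficient \<open>1\<close>,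
  hence strictly convex in \<open>x\<^sup>2\<close>. The proof uses the interpolation formula for such a
  quadratic. This replaces the convexity of the loop of the lemniscate; positivity of \<open>x1\<close> makes
  \<open>x \<mapsto> x\<^sup>2\<close> increasing on the segment.\<close>

lemma bernoulli_convex:
  assumes "0 < x1" "bernoulli x1 L \<le> 0" "bernoulli x2 L \<le> 0" "x1 \<le> x" "x \<le> x2"
  shows "bernoulli x L \<le> 0" "x1 < x \<Longrightarrow> x < x2 \<Longrightarrow> bernoulli x L < 0"
proof -
  show strict: "bernoulli x L < 0" if "x1 < x" "x < x2"
  proof -
    define t t1 t2 where "t = x\<^sup>2" and "t1 = x1\<^sup>2" and "t2 = x2\<^sup>2"
    have t: "t1 < t" "t < t2"
      using that assms(1) by (auto simp: t_def t1_def t2_def intro!: power_strict_mono)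
    define g where "g = (\<lambda>t. (t + L\<^sup>2)\<^sup>2 - 2 * t + 2 * L\<^sup>2)"
    have "(t2 - t1) * g t = (t2 - t) * g t1 + (t - t1) * g t2 - (t2 - t) * (t - t1) * (t2 - t1)"
      unfolding g_def by algebra
    moreover have "(t2 - t) * g t1 \<le> 0" "(t - t1) * g t2 \<le> 0"
      using t assms(2,3) unfolding g_def t1_def t2_def bernoulli_def
      by (auto intro!: mult_nonneg_nonpos)
    moreover have "0 < (t2 - t) * (t - t1) * (t2 - t1)"
      using t by simp
    ultimately have "(t2 - t1) * g t < 0"
      by linarith
    then have "g t < 0"
      using t by (simp add: mult_less_0_iff)
    then show ?thesis
      by (simp add: g_def t_def bernoulli_def)
  qed
  show "bernoulli x L \<le> 0"
    using strict assms by (cases "x = x1 \<or> x = x2") auto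
qed

lemma bernoulli_mono:
  assumes "\<bar>y\<bar> \<le> L"
  shows "bernoulli x y \<le> bernoulli x L" "\<bar>y\<bar> < L \<Longrightarrow> bernoulli x y < bernoulli x L"
proof -
  have le: "y\<^sup>2 \<le> L\<^sup>2"
    using assms by (metis abs_ge_zero power2_abs power_mono)
  then have "(x\<^sup>2 + y\<^sup>2)\<^sup>2 \<le> (x\<^sup>2 + L\<^sup>2)\<^sup>2"
    by (intro power_mono) auto
  then show "bernoulli x y \<le> bernoulli x L"
    using le unfolding bernoulli_def by linarith
  assume "\<bar>y\<bar> < L"
  then have "y\<^sup>2 < L\<^sup>2"
    by (metis abs_ge_zero power2_abs power_strict_mono zero_less_numeral)
  then show "bernoulli x y < bernoulli x L"
    using \<open>(x\<^sup>2 + y\<^sup>2)\<^sup>2 \<le> (x\<^sup>2 + L\<^sup>2)\<^sup>2\<close> unfolding bernoulli_def by linarith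
qed

text \<open>Moving a point vertically to the top or bottom side and then horizontally to a suitable corner does not
  decrease \<open>bernoulli\<close>, and increases it strictly in at least one of the two moves unless the
  point is itself a corner.\<close>

lemma rectangle_in_bernoulli:
  assumes "0 < x1" "bernoulli x1 L \<le> 0" "bernoulli x2 L \<le> 0"
    and "x1 \<le> x" "x \<le> x2" "\<bar>y\<bar> \<le> L"
    and "x1 < x \<and> x < x2 \<or> \<bar>y\<bar> < L"
  shows "bernoulli x y < 0"
  using assms(7) bernoulli_convex[OF assms(1-5)] bernoulli_mono[OF assms(6), of x] by linarith

section \<open>The corners of the rectangle as functions of the radius\<close>

lemma first_zero:
  fixes F :: "real \<Rightarrow> real"
  assumes F: "continuous_on {0..t} F" and "F 0 < 0" "0 < F t" "0 < t"
  obtains \<rho> where "0 < \<rho>" "\<rho> < t" "F \<rho> = 0" "\<And>s. 0 \<le> s \<Longrightarrow> s < \<rho> \<Longrightarrow> F s < 0"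
proof -
  have ivt: "\<exists>x. 0 \<le> x \<and> x \<le> b \<and> F x = 0" if "0 \<le> b" "b \<le> t" "0 \<le> F b" for b
    using that \<open>F 0 < 0\<close> by (intro IVT' continuous_on_subset[OF F]) auto
  define Z where "Z = {0..t} \<inter> F -` {0}"
  have "closed Z"
    using continuous_closed_preimage[OF F, of "{0}"] by (simp add: Z_def)
  moreover have "bounded Z"
    by (rule bounded_subset[of "{0..t}"]) (auto simp: Z_def)
  ultimately have "compact Z"
    by (simp add: compact_eq_bounded_closed)
  moreover have "Z \<noteq> {}"
    using ivt[of t] assms by (auto simp: Z_def)
  ultimately obtain \<rho> where \<rho>: "\<rho> \<in> Z" "\<And>s. s \<in> Z \<Longrightarrow> \<rho> \<le> s"
    using compact_attains_inf by metis
  show thesis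
  proof
    show "F \<rho> = 0"
      using \<rho> by (auto simp: Z_def)
    then show "0 < \<rho>" "\<rho> < t"
      using \<rho>(1) assms by (auto simp: Z_def order_less_le)
    fix s assume s: "0 \<le> s" "s < \<rho>"
    show "F s < 0"
    proof (rule ccontr)
      assume "\<not> F s < 0"
      then obtain x where "0 \<le> x" "x \<le> s" "F x = 0"
        using ivt[of s] s \<open>\<rho> < t\<close> by auto
      then show False
        using \<rho>(2)[of x] s \<open>\<rho> < t\<close> by (auto simp: Z_def)
    qed
  qed
qed

text \<open>The abscissae of the right (\<open>\<sigma> = 1\<close>) and left (\<open>\<sigma> = - 1\<close>) corners; one parameter lets both
  equations be treated together.\<close>

definition corner :: "real \<Rightarrow> real \<Rightarrow> real \<Rightarrow> real" where
  "corner \<sigma> \<alpha> r = 1 + (M1 r \<alpha> + \<sigma> * M2 r \<alpha>) / (2 * sin \<alpha>)"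

definition half_height :: "real \<Rightarrow> real \<Rightarrow> real" where
  "half_height \<alpha> r = ln (N r \<alpha>) / (2 * sin \<alpha>)"

lemma lemniscate_eq_iff_corner:
  "lemniscate_eq \<alpha> (M1 r \<alpha> + \<sigma> * M2 r \<alpha>) (ln (N r \<alpha>)) \<longleftrightarrow>
    bernoulli (corner \<sigma> \<alpha> r) (half_height \<alpha> r) = 0"
proof -
  have "(half_height \<alpha> r)\<^sup>2 = 1 / (4 * (sin \<alpha>)\<^sup>2) * (ln (N r \<alpha>))\<^sup>2"
    by (simp add: half_height_def power_divide power_mult_distrib)
  then show ?thesis
    unfolding lemniscate_eq_def bernoulli_def corner_def by auto
qed

lemma continuous_corner:
  assumes "0 < sin \<alpha>" "t < 1"
  shows "continuous_on {0..t} (corner \<sigma> \<alpha>)"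
proof -
  have D: "center_norm r \<alpha> \<noteq> 0" if "r \<in> {0..t}" for r
    using center_norm_pos[of r \<alpha>] that assms by auto
  have cD: "continuous_on {0..t} (\<lambda>r. center_norm r \<alpha>)"
    unfolding center_norm_def by (intro continuous_intros)
  have "continuous_on {0..t} (\<lambda>r. arcsin (- (r\<^sup>2) * sin (2 * \<alpha>) / center_norm r \<alpha>))"
    using assms M1_trig(3)[of _ \<alpha>] by (intro continuous_intros cD ballI D) auto
  moreover have "continuous_on {0..t} (\<lambda>r. arcsin (2 * r * sin \<alpha> / center_norm r \<alpha>))"
    using assms M2_trig(4)[of _ \<alpha>] by (intro continuous_intros cD ballI D) auto
  ultimately have "continuous_on {0..t} (\<lambda>r. M1 r \<alpha>)" "continuous_on {0..t} (\<lambda>r. M2 r \<alpha>)"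
    unfolding M1_def M2_def center_norm_def .
  moreover have "\<forall>r\<in>{0..t}. 2 * sin \<alpha> \<noteq> 0"
    using assms(1) by simp
  ultimately show ?thesis
    unfolding corner_def by (intro continuous_on_add continuous_on_divide continuous_on_mult continuous_on_const)
qed

lemma continuous_half_height:
  assumes "0 < sin \<alpha>" "t < 1"
  shows "continuous_on {0..t} (half_height \<alpha>)"
proof -
  have q: "1 - r\<^sup>2 \<noteq> 0" if "r \<in> {0..t}" for r
    using that assms power_less_one_iff[of r 2] by auto
  have "continuous_on {0..t} (\<lambda>r. N r \<alpha>)"
    unfolding N_def by (intro continuous_intros ballI q)
  moreover have "N r \<alpha> \<noteq> 0" if "r \<in> {0..t}" for r
    using ln_N(1)[of r \<alpha>] that assms by auto
  ultimately show ?thesis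
    unfolding half_height_def using assms by (intro continuous_intros) auto
qed

text \<open>From \<open>N \<ge> 2 t sin \<alpha> / (1 - t\<^sup>2) \<ge> sin \<alpha> / (2 (1 - t))\<close> for \<open>t \<ge> 1 / 2\<close>, the value
  \<open>1 - t = sin \<alpha> / (2 exp 2)\<close> makes \<open>ln N \<ge> 2 \<ge> 2 sin \<alpha>\<close>. Points of height at least \<open>1\<close> lie
  outside the lemniscate, whatever their abscissa.\<close>

lemma half_height_large:
  assumes "0 < sin \<alpha>"
  obtains t where "0 < t" "t < 1" "1 \<le> half_height \<alpha> t"
proof -
  let ?s = "sin \<alpha>"
  define t where "t = 1 - ?s / (2 * exp 2)"
  have "?s \<le> exp 2"
    using sin_le_one[of \<alpha>] one_le_exp_iff[of "2 :: real"] by linarith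
  then have "?s / (2 * exp 2) \<le> 1 / 2"
    by (simp add: field_simps)
  then have t: "1 / 2 \<le> t" "t < 1"
    using assms by (simp_all add: t_def)
  have q: "0 < 1 - t\<^sup>2"
    using t by (simp add: power_less_one_iff)
  have "(1 - t) * (1 + t) \<le> (1 - t) * 2"
    using t by (intro mult_left_mono) auto
  then have "exp 2 * (1 - t\<^sup>2) \<le> exp 2 * (2 * (1 - t))"
    by (intro mult_left_mono) (auto simp: algebra_simps power2_eq_square)
  also have "\<dots> = ?s"
    by (simp add: t_def)
  also have "\<dots> \<le> 2 * t * ?s"
    using t assms by simp
  also have "\<dots> \<le> center_norm t \<alpha> + 2 * t * ?s"
    using center_norm_pos[of t \<alpha>] t by simp
  finally have "exp 2 \<le> N t \<alpha>"
    unfolding N_def using q by (simp add: center_norm_def pos_le_divide_eq)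
  then have "2 \<le> ln (N t \<alpha>)"
    using ln_N(1)[of t \<alpha>] t assms by (simp add: ln_ge_iff)
  then have "1 \<le> half_height \<alpha> t"
    unfolding half_height_def using assms sin_le_one[of \<alpha>] by (subst pos_le_divide_eq) linarith+
  then show thesis
    using that[of t] t by simp
qed

lemma corner_least_root:
  assumes s: "0 < sin \<alpha>"
  obtains \<rho> where "0 < \<rho>" "\<rho> < 1"
    "least_positive_root (\<lambda>r. bernoulli (corner \<sigma> \<alpha> r) (half_height \<alpha> r) = 0) \<rho>"
    "\<And>r. 0 \<le> r \<Longrightarrow> r \<le> \<rho> \<Longrightarrow> bernoulli (corner \<sigma> \<alpha> r) (half_height \<alpha> r) \<le> 0"
proof -
  let ?F = "\<lambda>r. bernoulli (corner \<sigma> \<alpha> r) (half_height \<alpha> r)"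
  obtain t where t: "0 < t" "t < 1" "1 \<le> half_height \<alpha> t"
    using half_height_large[OF s] by blast
  have "continuous_on {0..t} ?F"
    unfolding bernoulli_def using s t
    by (intro continuous_intros continuous_corner continuous_half_height)
  moreover have "?F 0 < 0"
    by (simp add: bernoulli_def corner_def half_height_def M1_def M2_def N_def)
  moreover have "0 < ?F t"
  proof -
    let ?x = "corner \<sigma> \<alpha> t" and ?y = "half_height \<alpha> t"
    have "1 \<le> ?y\<^sup>2"
      using t by (simp add: one_le_power)
    then have "0 \<le> 2 * ?x\<^sup>2 * (?y\<^sup>2 - 1)" "0 < ?y ^ 4 + 2 * ?y\<^sup>2"
      using t by (auto intro!: add_pos_pos)
    moreover have "?F t = ?x ^ 4 + 2 * ?x\<^sup>2 * (?y\<^sup>2 - 1) + (?y ^ 4 + 2 * ?y\<^sup>2)"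
      unfolding bernoulli_def by algebra
    moreover have "0 \<le> ?x ^ 4"
      by simp
    ultimately show ?thesis
      by linarith
  qed
  ultimately obtain \<rho> where \<rho>: "0 < \<rho>" "\<rho> < t" "?F \<rho> = 0" "\<And>s. 0 \<le> s \<Longrightarrow> s < \<rho> \<Longrightarrow> ?F s < 0"
    using first_zero[of t ?F] t by blast
  show thesis
  proof
    show "0 < \<rho>" "\<rho> < 1"
      using \<rho> t by auto
    show "least_positive_root (\<lambda>r. ?F r = 0) \<rho>"
      unfolding least_positive_root_def using \<rho>(1,3) \<rho>(4)[OF less_imp_le] by force
    show "?F r \<le> 0" if "0 \<le> r" "r \<le> \<rho>" for r
      using \<rho>(3) \<rho>(4)[of r] that by (cases "r = \<rho>") auto
  qed
qed

text \<open>The interior of the lemniscate has a second loop in the left half plane. A path inside the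
  closed curve from \<open>1\<close> to that loop meets the imaginary axis, which is possible only at the node
  \<open>0\<close>; but the rectangle has positive height for \<open>r > 0\<close>.\<close>

lemma corner_positive:
  assumes s: "0 < sin \<alpha>" and \<rho>: "\<rho> < 1"
    and inside: "\<And>r. 0 \<le> r \<Longrightarrow> r \<le> \<rho> \<Longrightarrow> bernoulli (corner \<sigma> \<alpha> r) (half_height \<alpha> r) \<le> 0"
    and r: "0 \<le> r" "r \<le> \<rho>"
  shows "0 < corner \<sigma> \<alpha> r"
proof (rule ccontr)
  assume "\<not> 0 < corner \<sigma> \<alpha> r"
  moreover have c0: "corner \<sigma> \<alpha> 0 = 1"
    by (simp add: corner_def M1_def M2_def)
  ultimately obtain q where q: "0 \<le> q" "q \<le> r" "corner \<sigma> \<alpha> q = 0"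
    using IVT2'[of "corner \<sigma> \<alpha>" r 0 0] continuous_corner[OF s, of r] r \<rho> by auto
  have "q \<noteq> 0"
    using q c0 by auto
  then have "0 < half_height \<alpha> q"
    unfolding half_height_def using ln_N(3)[of q \<alpha>] s q r \<rho> by auto
  then have "0 < bernoulli (corner \<sigma> \<alpha> q) (half_height \<alpha> q)"
    unfolding q(3) bernoulli_def by (simp add: add_nonneg_pos)
  then show False
    using inside[of q] q r by auto
qed

section \<open>The inclusion\<close>

lemma class_MS_value_in_SL_region:
  assumes \<alpha>: "0 < \<alpha>" "\<alpha> < pi" and f: "f \<in> class_MS \<alpha>"
    and z: "z \<noteq> 0" "cmod z < 1"
    and left: "0 < corner (- 1) \<alpha> (cmod z)"
      "bernoulli (corner (- 1) \<alpha> (cmod z)) (half_height \<alpha> (cmod z)) \<le> 0"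
    and right: "bernoulli (corner 1 \<alpha> (cmod z)) (half_height \<alpha> (cmod z)) \<le> 0"
  shows "starlike_quot f z \<in> SL_region"
proof -
  let ?s = "2 * sin \<alpha>" and ?p = "starlike_quot f" and ?r = "cmod z"
  have s: "0 < ?s"
    using \<alpha> by (simp add: sin_gt_zero)
  define X where "X = (\<lambda>w. of_real ?s * (?p w - 1))"
  have "f \<in> class_A"
    using f by (simp add: class_MS_def)
  then have X_hol: "X holomorphic_on ball 0 1"
    unfolding X_def by (intro holomorphic_intros starlike_quot_holomorphic)
  have strip: "\<alpha> - pi < Re (X w) \<and> Re (X w) < \<alpha>" if "cmod w < 1" for w
  proof -
    have "1 + (\<alpha> - pi) / ?s < Re (?p w)" "Re (?p w) < 1 + \<alpha> / ?s"
      using f that by (auto simp: class_MS_def)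
    then have "(\<alpha> - pi) / ?s < Re (?p w) - 1" "Re (?p w) - 1 < \<alpha> / ?s"
      by auto
    then show ?thesis
      using s by (simp add: X_def pos_divide_less_eq pos_less_divide_eq mult_ac)
  qed
  have "(1 - ?r\<^sup>2) * cosh (Im (X z)) \<le> cos (Re (X z)) - ?r\<^sup>2 * cos (Re (X z) - 2 * \<alpha>)"
    by (rule strip_Schwarz[OF \<alpha> X_hol _ strip z(2)]) (auto simp: X_def starlike_quot_def)
  note R = disc_log_in_rectangle[OF \<alpha> _ z(2) _ _ this]
  have R: "\<bar>Re (X z) - M1 ?r \<alpha>\<bar> \<le> M2 ?r \<alpha>" "\<bar>Im (X z)\<bar> \<le> ln (N ?r \<alpha>)"
    "\<bar>Re (X z) - M1 ?r \<alpha>\<bar> < M2 ?r \<alpha> \<or> \<bar>Im (X z)\<bar> < ln (N ?r \<alpha>)"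
    using R strip[OF z(2)] z(1) by auto
  have p: "Re (?p z) = 1 + Re (X z) / ?s" "Im (?p z) = Im (X z) / ?s"
    using s by (auto simp: X_def)
  have abs_p: "\<bar>Im (?p z)\<bar> = \<bar>Im (X z)\<bar> / ?s"
    using s by (simp add: p(2) abs_divide)
  have Re_le: "corner (- 1) \<alpha> ?r \<le> Re (?p z)" "Re (?p z) \<le> corner 1 \<alpha> ?r"
    using R(1) s unfolding corner_def p abs_le_iff by (auto intro!: divide_right_mono)
  have Im_le: "\<bar>Im (?p z)\<bar> \<le> half_height \<alpha> ?r"
    unfolding abs_p half_height_def using R(2) s by (intro divide_right_mono) auto
  have strict: "corner (- 1) \<alpha> ?r < Re (?p z) \<and> Re (?p z) < corner 1 \<alpha> ?r \<or>
      \<bar>Im (?p z)\<bar> < half_height \<alpha> ?r"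
    using R(3)
  proof
    assume "\<bar>Re (X z) - M1 ?r \<alpha>\<bar> < M2 ?r \<alpha>"
    then have "corner (- 1) \<alpha> ?r < Re (?p z) \<and> Re (?p z) < corner 1 \<alpha> ?r"
      using s unfolding corner_def p abs_less_iff by (auto intro!: divide_strict_right_mono)
    then show ?thesis ..
  next
    assume "\<bar>Im (X z)\<bar> < ln (N ?r \<alpha>)"
    then show ?thesis
      unfolding abs_p half_height_def using s by (intro disjI2 divide_strict_right_mono)
  qed
  show ?thesis
    using rectangle_in_bernoulli[OF left right Re_le Im_le strict] left(1) Re_le(1)
    by (intro mem_SL_region) auto
qed

theorem theorem8:
  fixes \<alpha> :: real
  assumes "pi / 2 \<le> \<alpha>" and "\<alpha> < pi"
  shows "\<exists>r3 r4.
    r3 \<in> {0<..<1} \<and> least_positive_root (\<lambda>r. lemniscate_eq \<alpha> (M1 r \<alpha> + M2 r \<alpha>) (ln (N r \<alpha>))) r3 \<and>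
    r4 \<in> {0<..<1} \<and> least_positive_root (\<lambda>r. lemniscate_eq \<alpha> (M1 r \<alpha> - M2 r \<alpha>) (ln (N r \<alpha>))) r4 \<and>
    class_MS \<alpha> \<subseteq> class_SL_on (cball 0 (min r3 r4))"
proof -
  have \<alpha>: "0 < \<alpha>"
    using assms(1) pi_gt_zero by linarith
  have s: "0 < sin \<alpha>"
    using \<alpha> assms(2) by (rule sin_gt_zero)
  obtain r3 where r3: "0 < r3" "r3 < 1"
      "least_positive_root (\<lambda>r. bernoulli (corner 1 \<alpha> r) (half_height \<alpha> r) = 0) r3"
    and right: "\<And>r. 0 \<le> r \<Longrightarrow> r \<le> r3 \<Longrightarrow> bernoulli (corner 1 \<alpha> r) (half_height \<alpha> r) \<le> 0"
    using corner_least_root[OF s, of 1] by metis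
  obtain r4 where r4: "0 < r4" "r4 < 1"
      "least_positive_root (\<lambda>r. bernoulli (corner (- 1) \<alpha> r) (half_height \<alpha> r) = 0) r4"
    and left: "\<And>r. 0 \<le> r \<Longrightarrow> r \<le> r4 \<Longrightarrow> bernoulli (corner (- 1) \<alpha> r) (half_height \<alpha> r) \<le> 0"
    using corner_least_root[OF s, of "- 1"] by metis
  have "starlike_quot f z \<in> SL_region" if f: "f \<in> class_MS \<alpha>" and z: "z \<in> cball 0 (min r3 r4)" for f z
  proof (cases "z = 0")
    case True
    then show ?thesis
      by (intro mem_SL_region) (auto simp: starlike_quot_def bernoulli_def)
  next
    case False
    have "cmod z \<le> r3" "cmod z \<le> r4"
      using z by auto
    then show ?thesis
      using False r4(2) corner_positive[OF s r4(2) left]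
      by (intro class_MS_value_in_SL_region[OF \<alpha> assms(2) f] left right) auto
  qed
  then have "class_MS \<alpha> \<subseteq> class_SL_on (cball 0 (min r3 r4))"
    by (auto simp: class_SL_on_def class_MS_def)
  then show ?thesis
    using r3 r4 lemniscate_eq_iff_corner[of \<alpha> _ 1] lemniscate_eq_iff_corner[of \<alpha> _ "- 1"]
    by (intro exI[of _ r3] exI[of _ r4]) simp
qed

end
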